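(* For every multi-objective optimization problem (MOO) with non-empty set of non-dominated points it holds that $\mathcal{Y}_{S\lambda}\subseteq\mathcal{Y}_{SNF}$. Moreover, there exist MOO instances for which the inclusion is strict, i.e. $\mathcal{Y}_{S\lambda}\subsetneq\mathcal{Y}_{SNF}$.
   Context: A multi-objective optimization problem (MOO) is the problem $\min_{x\in\mathcal{X}} f(x)=(f_1(x),\dots,f_p(x))^\top$, where $p\ge 2$, $f:\mathbb{R}^n\to\mathbb{R}^p$ is a vector-valued function and $\mathcal{X}\subseteq\mathbb{R}^n$ is the set of feasible solutions; its outcome set is $\mathcal{Y}=f(\mathcal{X})$. For $y^1,y^2\in\mathbb{R}^p$: $y^1\leqq y^2$ means $y^1_i\le y^2_i$ for all $i$; $y^1\le y^2$ means $y^1\leqq y^2$ and $y^1\neq y^2$; $y^1<y^2$ means $y^1_i<y^2_i$ for all $i$. Let $\mathbb{R}^p_{\geqq}=\{y\in\mathbb{R}^p : y\geqq 0\}$ and $\mathbb{R}^p_{>}=\{y\in\mathbb{R}^p : y>0\}$. A feasible solution $x^*\in\mathcal{X}$ is efficient if there is no $x\in\mathcal{X}$ with $f(x)\le f(x^* )$ (that is, $f(x)\leqq f(x^* )$ and $f(x)\ne f(x^* )$); its image $f(x^* )$ is then called non-dominated. $\mathcal{Y}_N\subseteq\mathcal{Y}$ is the set of non-dominated points. Let $\Lambda_p=\{\lambda\in\mathbb{R}^p_{>} : \sum_{i=1}^p\lambda_i=1\}$, and let $P_\lambda$ denote the weighted-sum problem $\min_{x\in\mathcal{X}}\lambda^\top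 f(x)$. $\mathcal{Y}_{S\lambda}$ is the set of all images $f(x)$ of efficient solutions $x\in\mathcal{X}$ for which there exists $\lambda\in\Lambda_p$ such that $x$ is an optimal solution of $P_\lambda$. $\mathcal{Y}_{SNF}$ is the set of all $y\in\mathcal{Y}_N$ that lie on the non-dominated frontier $\{y\in\operatorname{conv}(\mathcal{Y}_N) : \operatorname{conv}(\mathcal{Y}_N)\cap(y-\mathbb{R}^p_{\geqq})=\{y\}\}$. *)

theory Defs
  imports "HOL-Analysis.Analysis"
begin

text \<open>
  A multi-objective optimization problem is given by an objective function
  \<open>f :: real^'n \<Rightarrow> real^'p\<close> and a feasible set \<open>X\<close>.  The library order \<open>\<le>\<close> on \<open>real^'p\<close> is
  the componentwise one, i.e. the relation written with a double bar in the literature on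
  multi-objective optimization.  The library's \<open><\<close> on vectors means \<open>\<le>\<close> and \<open>\<noteq>\<close>, so strict
  componentwise inequality is always spelled out below.
\<close>

definition nonneg_orthant :: "(real^'p) set" where
  "nonneg_orthant = {y. 0 \<le> y}"

definition pos_orthant :: "(real^'p) set" where
  "pos_orthant = {y. \<forall>i. 0 < y $ i}"

definition efficient :: "(real^'n) set \<Rightarrow> (real^'n \<Rightarrow> real^'p) \<Rightarrow> real^'n \<Rightarrow> bool" where
  "efficient X f x \<longleftrightarrow> x \<in> X \<and> \<not> (\<exists>x'\<in>X. f x' \<le> f x \<and> f x' \<noteq> f x)"

definition nondominated :: "(real^'n) set \<Rightarrow> (real^'n \<Rightarrow> real^'p) \<Rightarrow> (real^'p) set" where
  "nondominated X f = f ` {x. efficient X f x}"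

definition weights :: "(real^'p) set" where
  "weights = {w \<in> pos_orthant. (\<Sum>i\<in>UNIV. w $ i) = 1}"

definition weighted_sum_optimal ::
    "(real^'n) set \<Rightarrow> (real^'n \<Rightarrow> real^'p) \<Rightarrow> real^'p \<Rightarrow> real^'n \<Rightarrow> bool" where
  "weighted_sum_optimal X f w x \<longleftrightarrow> is_arg_min (\<lambda>x. w \<bullet> f x) (\<lambda>x. x \<in> X) x"

definition Y_S_weighted :: "(real^'n) set \<Rightarrow> (real^'n \<Rightarrow> real^'p) \<Rightarrow> (real^'p) set" where
  "Y_S_weighted X f =
     f ` {x. efficient X f x \<and> (\<exists>w\<in>weights. weighted_sum_optimal X f w x)}"

definition nondominated_frontier :: "(real^'n) set \<Rightarrow> (real^'n \<Rightarrow> real^'p) \<Rightarrow> (real^'p) set" where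
  "nondominated_frontier X f =
     {y \<in> convex hull nondominated X f.
        convex hull nondominated X f \<inter> {y - r |r. r \<in> nonneg_orthant} = {y}}"

definition Y_SNF :: "(real^'n) set \<Rightarrow> (real^'n \<Rightarrow> real^'p) \<Rightarrow> (real^'p) set" where
  "Y_SNF X f = nondominated X f \<inter> nondominated_frontier X f"

end

theory Submission
  imports Defs
begin

text \<open>
  A weighted-sum optimum \<open>y\<close> minimizes the linear functional \<open>w \<bullet> _\<close> over the convex hull of the
  non-dominated points. Since all weights are positive, the functional strictly decreases in every
  direction of \<open>y - \<real>\<^sup>p\<^sub>\<ge>\<close>, so this cone meets the hull in \<open>y\<close> only. For strictness, the outcome
  curve \<open>(s, s\<^sup>2)\<close> with \<open>s \<le> 0\<close> is supported at the origin only by the horizontal line, that is,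
  by a weight with a zero entry.
\<close>

text \<open>All terms \<open>w $ i * r $ i\<close> are non-negative, so a sum of at most 0 forces
  each to vanish, and the positive factor \<open>w $ i\<close> cancels.\<close>

lemma weights_inner_nonpos_imp_zero:
  fixes w r :: "real^'p"
  assumes "w \<in> weights" "0 \<le> r" "w \<bullet> r \<le> 0"
  shows "r = 0"
proof -
  have w: "0 < w $ i" for i
    using assms(1) by (simp add: weights_def pos_orthant_def)
  have r: "0 \<le> r $ i" for i
    using assms(2) by (simp add: less_eq_vec_def)
  have nn: "0 \<le> w $ i * r $ i" for i
    by (simp add: w r less_imp_le)
  have "(\<Sum>i\<in>UNIV. w $ i * r $ i) = 0"
    using assms(3) nn by (simp add: inner_vec_def sum_nonneg antisym)
  then have "w $ i * r $ i = 0" for i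
    using nn by (simp add: sum_nonneg_eq_0_iff)
  then show ?thesis
    using w by (simp add: vec_eq_iff) (metis less_irrefl)
qed

text \<open>Subtracting the orthant from \<open>y\<close> yields exactly the points \<le>
  \<open>y\<close> (take \<open>r = y - z\<close>), so the frontier condition is minimality of
  \<open>y\<close> in the hull under the componentwise order.\<close>

lemma nondominated_frontierI:
  assumes "y \<in> convex hull nondominated X f"
    and "\<And>z. z \<in> convex hull nondominated X f \<Longrightarrow> z \<le> y \<Longrightarrow> z = y"
  shows "y \<in> nondominated_frontier X f"
proof -
  have "{y - r |r. r \<in> nonneg_orthant} = {z. z \<le> y}"
  proof (intro equalityI subsetI)
    fix z assume "z \<in> {z. z \<le> y}"
    then have "z = y - (y - z)" "y - z \<in> nonneg_orthant"
      by (simp_all add: nonneg_orthant_def less_eq_vec_def)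
    then show "z \<in> {y - r |r. r \<in> nonneg_orthant}" by blast
  qed (auto simp: nonneg_orthant_def less_eq_vec_def)
  then show ?thesis
    using assms by (auto simp: nondominated_frontier_def)
qed

lemma Y_S_weighted_subset_Y_SNF: "Y_S_weighted X f \<subseteq> Y_SNF X f"
proof
  fix y assume "y \<in> Y_S_weighted X f"
  then obtain x w where x: "efficient X f x" "y = f x" and w: "w \<in> weights"
    and opt: "weighted_sum_optimal X f w x"
    by (auto simp: Y_S_weighted_def)
  have y: "y \<in> nondominated X f"
    using x by (auto simp: nondominated_def)
  \<comment> \<open>Efficient solutions are feasible, so optimality over \<open>X\<close> bounds
    their images; convexity of the half-space carries the bound to the hull.\<close>
  have "nondominated X f \<subseteq> {z. w \<bullet> z \<ge> w \<bullet> y}"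
    using opt x(2)
    by (auto simp: nondominated_def efficient_def weighted_sum_optimal_def is_arg_min_linorder)
  then have hull: "convex hull nondominated X f \<subseteq> {z. w \<bullet> z \<ge> w \<bullet> y}"
    by (rule hull_minimal) (rule convex_halfspace_ge)
  have "y \<in> nondominated_frontier X f"
  proof (rule nondominated_frontierI)
    fix z assume z: "z \<in> convex hull nondominated X f" "z \<le> y"
    have "y - z = 0"
    proof (rule weights_inner_nonpos_imp_zero[OF w])
      show "0 \<le> y - z" using z(2) by (simp add: less_eq_vec_def)
      show "w \<bullet> (y - z) \<le> 0" using z(1) hull by (auto simp: inner_diff_right)
    qed
    then show "z = y" by simp
  qed (simp add: y hull_inc)
  then show "y \<in> Y_SNF X f"
    using y by (simp add: Y_SNF_def)
qed

text \<open>Serves to enclose the hull in the example: unlike the closed half-space, this set meets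
  \<open>y $ b \<le> 0\<close> only at the origin.\<close>

lemma convex_open_halfspace_insert_zero:
  fixes b :: "'p::finite"
  shows "convex {y :: real^'p. y = 0 \<or> 0 < y $ b}"
proof (rule convexI)
  fix x y :: "real^'p" and u v :: real
  assume xy: "x \<in> {y. y = 0 \<or> 0 < y $ b}" "y \<in> {y. y = 0 \<or> 0 < y $ b}"
    and uv: "0 \<le> u" "0 \<le> v" "u + v = 1"
  show "u *\<^sub>R x + v *\<^sub>R y \<in> {y. y = 0 \<or> 0 < y $ b}"
  proof (cases "u = 0 \<or> v = 0")
    case True
    then show ?thesis using xy uv by auto
  next
    case False
    then have "0 < u" "0 < v" using uv by auto
    then show ?thesis using xy by (auto intro: add_pos_pos)
  qed
qed

lemma exists_Y_S_weighted_psubset_Y_SNF: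
  assumes "CARD('p::finite) \<ge> 2"
  shows "\<exists>(X :: (real^'n::finite) set) (f :: real^'n \<Rightarrow> real^'p). Y_S_weighted X f \<subset> Y_SNF X f"
proof -
  obtain a b :: 'p where ab: "a \<noteq> b"
    using assms by (metis UNIV_I card_2_iff' ex_card)
  \<comment> \<open>Any coordinate will do, and \<open>undefined\<close> merely picks one;
    \<open>f\<close> depends on \<open>x\<close> through \<open>x $ k\<close> alone, so every domain
    dimension is covered.\<close>
  define k :: 'n where "k = undefined"
  define X :: "(real^'n) set" where "X = {x. x $ k \<le> 0}"
  define f :: "real^'n \<Rightarrow> real^'p"
    where "f x = (\<chi> i. if i = a then x $ k else if i = b then (x $ k)\<^sup>2 else 0)" for x
  have fa: "f x $ a = x $ k" and fb: "f x $ b = (x $ k)\<^sup>2" for x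
    using ab by (auto simp: f_def)
  have f0: "f x = 0 \<longleftrightarrow> x $ k = 0" for x
    using fa by (auto simp: f_def vec_eq_iff)
  have nd: "0 \<in> nondominated X f"
  proof -
    have "f x = 0" if "f x \<le> 0" for x
    proof -
      have "(x $ k)\<^sup>2 \<le> 0"
        using that fb[of x] unfolding less_eq_vec_def by (metis zero_index)
      then show ?thesis by (simp add: f0)
    qed
    then have "efficient X f 0"
      by (simp add: efficient_def X_def f0[of 0, THEN iffD2])
    moreover have "f 0 = 0" by (simp add: f0)
    ultimately show ?thesis
      unfolding nondominated_def by (metis (mono_tags) image_eqI mem_Collect_eq)
  qed
  \<comment> \<open>The \<open>b\<close> entry is a square, which vanishes only when
    \<open>f x = 0\<close>.\<close>
  have "nondominated X f \<subseteq> {y. y = 0 \<or> 0 < y $ b}"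
    by (auto simp: nondominated_def f0 fb)
  then have hull: "convex hull nondominated X f \<subseteq> {y. y = 0 \<or> 0 < y $ b}"
    by (rule hull_minimal) (rule convex_open_halfspace_insert_zero)
  have "0 \<in> nondominated_frontier X f"
  proof (rule nondominated_frontierI)
    fix z assume z: "z \<in> convex hull nondominated X f" "z \<le> 0"
    have "z $ b \<le> 0"
      using z(2) unfolding less_eq_vec_def by (metis zero_index)
    then show "z = 0" using z(1) hull by force
  qed (simp add: nd hull_inc)
  then have SNF: "0 \<in> Y_SNF X f"
    using nd by (simp add: Y_SNF_def)
  have "0 \<notin> Y_S_weighted X f"
  proof
    assume "0 \<in> Y_S_weighted X f"
    then obtain x w where w: "w \<in> weights" and "f x = 0"
      and "weighted_sum_optimal X f w x"
      by (auto simp: Y_S_weighted_def)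
    \<comment> \<open>Since \<open>f x = 0\<close>, the optimal value is 0, so a feasible point with
      negative weighted sum gives the contradiction.\<close>
    then have opt: "0 \<le> w \<bullet> f x'" if "x' \<in> X" for x'
      using that by (auto simp: weighted_sum_optimal_def is_arg_min_linorder)
    have pos: "0 < w $ a" "0 < w $ b"
      using w by (auto simp: weights_def pos_orthant_def)
    \<comment> \<open>minimizer of \<open>w\<^sub>a s + w\<^sub>b s\<^sup>2\<close>\<close>
    define s where "s = - (w $ a / (2 * w $ b))"
    have s: "s < 0" using pos by (simp add: s_def)
    \<comment> \<open>The constant vector is feasible because its entry at \<open>k\<close> is
      \<open>s < 0\<close>.\<close>
    have "w \<bullet> f (\<chi> i. s) = (\<Sum>i\<in>UNIV. w $ i * f (\<chi> i. s) $ i)"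
      by (simp add: inner_vec_def)
    also have "\<dots> = (\<Sum>i\<in>{a, b}. w $ i * f (\<chi> i. s) $ i)"
      by (rule sum.mono_neutral_right) (auto simp: f_def)
    also have "\<dots> = s * (w $ a + w $ b * s)"
      using ab by (simp add: fa fb power2_eq_square algebra_simps)
    also have "w $ a + w $ b * s = w $ a / 2"
      using pos by (simp add: s_def field_simps)
    also have "s * (w $ a / 2) < 0"
      using s pos by (simp add: mult_neg_pos)
    finally show False
      using opt[of "\<chi> i. s"] s by (simp add: X_def)
  qed
  with SNF Y_S_weighted_subset_Y_SNF[of X f] show ?thesis by blast
qed

theorem theorem2p11:
  assumes "CARD('p::finite) \<ge> 2"
  shows "(\<forall>(X :: (real^'n::finite) set) (f :: real^'n \<Rightarrow> real^'p).
            nondominated X f \<noteq> {} \<longrightarrow> Y_S_weighted X f \<subseteq> Y_SNF X f)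
       \<and> (\<exists>(X :: (real^'n) set) (f :: real^'n \<Rightarrow> real^'p). Y_S_weighted X f \<subset> Y_SNF X f)"
  using Y_S_weighted_subset_Y_SNF exists_Y_S_weighted_psubset_Y_SNF[OF assms] by blast

end
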